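(* Let $a<b$ be real numbers, let $\alpha>0$, let $n,N\in\mathbb{N}$ with $N\ge n\ge 1$, and let $x\in C^n[a,b]$. For $t\in(a,b]$ let $$ E_{tr}(t)={_aI_t^\alpha}x(t)-\left[\sum_{i=0}^{n-1}A_i(\alpha,N)(t-a)^{\alpha+i}x^{(i)}(t)+\sum_{p=n}^N B(\alpha,p)(t-a)^{\alpha+n-1-p}V_p(t)\right], $$ where, for $i=0,\ldots,n-1$, $$ A_i(\alpha,N)=\frac{1}{\Gamma(\alpha+i+1)}\left[1+\sum_{p=n-i}^N\frac{\Gamma(p-\alpha-n+1)}{\Gamma(-\alpha-i)\,(p-n+1+i)!}\right], $$ and, for $p=n,\ldots,N$, $$ B(\alpha,p)=\frac{\Gamma(p-\alpha-n+1)}{\Gamma(\alpha)\Gamma(1-\alpha)\,(p-n+1)!},\qquad V_p(t)=\int_a^t (p-n+1)(\tau-a)^{p-n}x(\tau)\,d\tau . $$ Then $$ |E_{tr}(t)|\le L_n\,\frac{(t-a)^{\alpha+n}\,e^{(\alpha+n-1)^2+\alpha+n-1}}{\Gamma(\alpha+n)\,(\alpha+n-1)\,N^{\alpha+n-1}},\qquad\text{where } L_n=\max_{\tau\in[a,t]}|x^{(n)}(\tau)| . $$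
   Context: For $\alpha>0$ and an integrable function $x$ on $[a,b]$, the left Riemann--Liouville fractional integral of order $\alpha$ is $$ {_aI_t^\alpha}x(t)=\frac{1}{\Gamma(\alpha)}\int_a^t (t-\tau)^{\alpha-1}x(\tau)\,d\tau,\qquad t\in[a,b], $$ where $\Gamma$ is Euler's Gamma function. Quotients of Gamma functions whose arguments differ by a nonnegative integer are read as $\Gamma(c+k)/\Gamma(c)=c(c+1)\cdots(c+k-1)$ (equal to $1$ for $k=0$); this gives them a meaning also when $\alpha$ is an integer. Thus $\Gamma(p-\alpha-n+1)/\Gamma(-\alpha-i)$ is this product with $c=-\alpha-i$, $k=p-n+1+i$, and $\Gamma(p-\alpha-n+1)/\Gamma(1-\alpha)$ is this product with $c=1-\alpha$, $k=p-n$. *)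

theory Defs
  imports "HOL-Analysis.Analysis"
begin

text \<open>Derivatives are taken within \<open>S\<close>, so that for \<open>S = {a..b}\<close> they are one-sided at the
  end points and values of \<open>x\<close> outside \<open>[a,b]\<close> play no role.\<close>

definition nth_deriv_on :: "real set \<Rightarrow> nat \<Rightarrow> (real \<Rightarrow> real) \<Rightarrow> real \<Rightarrow> real" where
  "nth_deriv_on S k x = ((\<lambda>f t. vector_derivative f (at t within S)) ^^ k) x"

definition C_on :: "nat \<Rightarrow> real set \<Rightarrow> (real \<Rightarrow> real) \<Rightarrow> bool" where
  "C_on n S x \<longleftrightarrow>
     (\<forall>i<n. nth_deriv_on S i x differentiable_on S) \<and> continuous_on S (nth_deriv_on S n x)"

definition RL_integral :: "real \<Rightarrow> real \<Rightarrow> (real \<Rightarrow> real) \<Rightarrow> real \<Rightarrow> real" where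
  "RL_integral a \<alpha> x t =
     1 / Gamma \<alpha> * integral {a..t} (\<lambda>\<tau>. (t - \<tau>) powr (\<alpha> - 1) * x \<tau>)"

text \<open>The quotients \<open>\<Gamma>(c + k) / \<Gamma>(c)\<close> are read as \<open>pochhammer c k = c (c + 1) \<dots> (c + k - 1)\<close>,
  which is also meaningful when \<open>c\<close> is a pole of \<open>\<Gamma>\<close>. In \<open>coeff_A\<close> the integer \<open>p - n + 1 + i\<close> is
  written \<open>p + 1 + i - n\<close> because \<open>p\<close> may be smaller than \<open>n\<close> and natural subtraction truncates.\<close>

definition coeff_A :: "real \<Rightarrow> nat \<Rightarrow> nat \<Rightarrow> nat \<Rightarrow> real" where
  "coeff_A \<alpha> n N i =
     1 / Gamma (\<alpha> + real i + 1) *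
     (1 + (\<Sum>p=n-i..N. pochhammer (- \<alpha> - real i) (p + 1 + i - n) / fact (p + 1 + i - n)))"

definition coeff_B :: "real \<Rightarrow> nat \<Rightarrow> nat \<Rightarrow> real" where
  "coeff_B \<alpha> n p = pochhammer (1 - \<alpha>) (p - n) / (Gamma \<alpha> * fact (p - n + 1))"

definition moment_V :: "real \<Rightarrow> nat \<Rightarrow> (real \<Rightarrow> real) \<Rightarrow> nat \<Rightarrow> real \<Rightarrow> real" where
  "moment_V a n x p t = integral {a..t} (\<lambda>\<tau>. real (p - n + 1) * (\<tau> - a) ^ (p - n) * x \<tau>)"

definition E_tr ::
    "real \<Rightarrow> real \<Rightarrow> real \<Rightarrow> nat \<Rightarrow> nat \<Rightarrow> (real \<Rightarrow> real) \<Rightarrow> real \<Rightarrow> real" where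
  "E_tr a b \<alpha> n N x t =
     RL_integral a \<alpha> x t -
     ((\<Sum>i=0..n-1. coeff_A \<alpha> n N i * (t - a) powr (\<alpha> + real i) * nth_deriv_on {a..b} i x t) +
      (\<Sum>p=n..N. coeff_B \<alpha> n p * (t - a) powr (\<alpha> + real n - 1 - real p) * moment_V a n x p t))"

end

theory Submission
  imports Defs
begin

text \<open>Write \<open>\<beta> = \<alpha> + n - 1\<close>. Replacing \<open>(1 - u)\<^sup>\<beta>\<close>, \<open>u = (\<tau> - a) / (t - a)\<close>, by its binomial polynomial
  of degree \<open>N\<close> in the kernel \<open>(t - \<tau>)\<^sup>\<beta>\<close> leaves a remainder kernel \<open>K\<^sub>n\<close>, and \<open>E_tr\<close> is the integral
  of \<open>K\<^sub>n x\<^sup>(\<^sup>n\<^sup>)\<close>: the kernels \<open>K\<^sub>i\<close> with exponent \<open>\<alpha> + i - 1\<close> and degree \<open>N - n + i\<close> satisfy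
  \<open>K\<^sub>i' = - K\<^sub>i\<^sub>-\<^sub>1\<close> and vanish at \<open>a\<close>, so \<open>n\<close> integrations by parts produce the \<open>A\<^sub>i\<close> as boundary terms at
  \<open>t\<close> and the fractional integral minus the \<open>B\<close> terms as the integral of \<open>K\<^sub>0 x\<close>. The remainder is
  bounded by the tail of the binomial series, whose coefficients are at most
  \<open>exp (\<beta>\<^sup>2 + \<beta>) / p\<^sup>\<beta>\<^sup>+\<^sup>1\<close>.\<close>

section \<open>Size of the binomial coefficients\<close>

lemma pochhammer_fact_Suc:
  fixes c :: real
  shows "pochhammer c (Suc p) / fact (Suc p) = pochhammer c p / fact p * ((c + real p) / real (Suc p))"
  by (simp add: pochhammer_Suc field_simps)

text \<open>Each factor \<open>(\<beta> + 1) / j - 1\<close> is nonnegative for \<open>j \<le> \<beta> + 1\<close> and is estimated by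
  \<open>s \<le> exp (s - 1)\<close>; the resulting harmonic sum is at most \<open>1 + ln p\<close>.\<close>

lemma abs_pochhammer_fact_le_exp:
  fixes \<beta> :: real
  assumes "1 \<le> p" "real p \<le> \<beta> + 1"
  shows "\<bar>pochhammer (- \<beta>) p / fact p\<bar> \<le> exp ((\<beta> + 1) * (1 + ln p) - 2 * real p)"
  using assms
proof (induction p rule: nat_induct_at_least)
  case base
  then show ?case
    using exp_ge_add_one_self[of "\<beta> - 1"] by simp
next
  case (Suc p)
  define s where "s = (\<beta> + 1) / real (Suc p) - 1"
  have s: "0 \<le> s" "\<bar>- \<beta> + real p\<bar> / real (Suc p) = s"
    using Suc.prems by (auto simp: s_def field_simps)
  have "1 / real (Suc p) \<le> ln (Suc p) - ln p"
  proof -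
    have "ln (real p / Suc p) \<le> real p / Suc p - 1"
      using Suc.hyps by (intro ln_le_minus_one) auto
    also have "\<dots> = - (1 / Suc p)"
      by (simp add: field_simps)
    finally show ?thesis
      using Suc.hyps by (simp add: ln_div)
  qed
  then have "(\<beta> + 1) * (1 / Suc p) \<le> (\<beta> + 1) * (ln (Suc p) - ln p)"
    using Suc.prems by (intro mult_left_mono) auto
  \<comment> \<open>The \<open>-2\<close> per step in the exponent collects the \<open>-1\<close> in
    \<open>s\<close> and the \<open>-1\<close> from \<open>s \<le> exp (s - 1)\<close>.\<close>
  then have step: "s - 1 \<le> (\<beta> + 1) * (ln (Suc p) - ln p) - 2"
    by (simp add: s_def)
  have "\<bar>pochhammer (- \<beta>) (Suc p) / fact (Suc p)\<bar> = \<bar>pochhammer (- \<beta>) p / fact p\<bar> * s"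
    unfolding pochhammer_fact_Suc abs_mult using s by (simp add: abs_divide)
  also have "\<dots> \<le> exp ((\<beta> + 1) * (1 + ln p) - 2 * real p) * exp (s - 1)"
    using Suc s exp_ge_add_one_self[of "s - 1"] by (intro mult_mono) auto
  also have "\<dots> \<le> exp ((\<beta> + 1) * (1 + ln (Suc p)) - 2 * real (Suc p))"
    using step unfolding exp_add[symmetric] by (simp add: algebra_simps)
  finally show ?case .
qed

text \<open>The tangent of \<open>ln\<close> at 2, with \<open>ln 2\<close> rounded up to 1. It
  trades the two logarithms in the exponent below for a single linear term.\<close>

lemma ln_le_half: "0 < x \<Longrightarrow> ln x \<le> x / 2" for x :: real
proof -
  assume "0 < x"
  then have "ln (x / 2) \<le> x / 2 - 1"
    by (intro ln_le_minus_one) auto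
  moreover have "ln x = ln (x / 2) + ln 2"
    using \<open>0 < x\<close> by (simp add: ln_div)
  moreover have "ln 2 \<le> (1::real)"
    using ln_le_minus_one[of 2] by simp
  ultimately show ?thesis by linarith
qed

text \<open>Bernoulli's inequality for real exponents: a convex function lies above its tangent,
  here the one at 1.\<close>

lemma one_plus_mult_le_powr:
  fixes q x :: real
  assumes "1 \<le> q" "0 < x"
  shows "1 + q * (x - 1) \<le> x powr q"
proof -
  have "q * (x - 1) \<le> x powr q - 1 powr q"
    using assms
    by (intro convex_on_imp_above_tangent[where A = "{0<..}"] powr_convex)
       (auto intro!: derivative_eq_intros simp: interior_open)
  then show ?thesis by simp
qed

text \<open>Up to \<open>p = \<beta> + 1\<close> the left-hand side is bounded directly; from there on it decreases in \<open>p\<close>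
  by Bernoulli's inequality.\<close>

lemma abs_pochhammer_fact_le:
  fixes \<beta> :: real
  assumes "0 < \<beta>" "1 \<le> p"
  shows "\<bar>pochhammer (- \<beta>) p / fact p\<bar> * real p powr (\<beta> + 1) \<le> exp (\<beta>\<^sup>2 + \<beta>)"
  using \<open>1 \<le> p\<close>
proof (induction p rule: nat_induct_at_least)
  case base
  have "\<beta> \<le> exp (\<beta>\<^sup>2 + \<beta>)"
    using exp_ge_add_one_self[of "\<beta>\<^sup>2 + \<beta>"] zero_le_power2[of \<beta>] by linarith
  then show ?case using \<open>0 < \<beta>\<close> by simp
next
  case (Suc p)
  let ?r = "real (Suc p)" and ?q = "\<beta> + 1"
  show ?case
  proof (cases "?r \<le> ?q")
    case True
    \<comment> \<open>Since \<open>2 \<le> ?r \<le> ?q\<close>, this gives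
      \<open>?r * (?q - 2) \<le> ?q * (?q - 2)\<close>. The exponent
      \<open>?q + 2 * ?q * ln ?r - 2 * ?r\<close> is then at most
      \<open>?q + ?r * (?q - 2) \<le> ?q * (?q - 1)\<close>, which is the constant
      \<open>\<beta>\<^sup>2 + \<beta>\<close>.\<close>
    have "0 \<le> (?q - ?r) * (?q - 2)"
      using True Suc.hyps by (intro mult_nonneg_nonneg) auto
    moreover have "?q * (2 * ln ?r) \<le> ?q * ?r"
      using ln_le_half[of ?r] \<open>0 < \<beta>\<close> by (intro mult_left_mono) auto
    ultimately have expo: "?q * (1 + ln ?r) - 2 * ?r + ?q * ln ?r \<le> \<beta>\<^sup>2 + \<beta>"
      by (simp add: power2_eq_square algebra_simps)
    have "\<bar>pochhammer (- \<beta>) (Suc p) / fact (Suc p)\<bar> * ?r powr ?q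
        \<le> exp (?q * (1 + ln ?r) - 2 * ?r) * exp (?q * ln ?r)"
      using abs_pochhammer_fact_le_exp[of "Suc p" \<beta>] True
      by (intro mult_mono) (auto simp: powr_def)
    also have "\<dots> \<le> exp (\<beta>\<^sup>2 + \<beta>)"
      using expo unfolding exp_add[symmetric] by simp
    finally show ?thesis .
  next
    case False
    \<comment> \<open>Beyond \<open>?q\<close> the factor leading from \<open>p\<close> to
      \<open>Suc p\<close> equals \<open>1 - ?q / ?r\<close>, exactly the Bernoulli lower bound for
      \<open>(p / ?r) powr ?q\<close>.\<close>
    have "1 + ?q * (real p / ?r - 1) \<le> (real p / ?r) powr ?q"
      using assms Suc.hyps by (intro one_plus_mult_le_powr) auto
    moreover have "real p / ?r - 1 = - (1 / ?r)"
      by (simp add: field_simps)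
    ultimately have "1 - ?q / ?r \<le> real p powr ?q / ?r powr ?q"
      by (simp add: powr_divide)
    moreover have "\<bar>- \<beta> + real p\<bar> / ?r = 1 - ?q / ?r"
      using False by (simp add: field_simps)
    ultimately have le: "\<bar>- \<beta> + real p\<bar> / ?r * ?r powr ?q \<le> real p powr ?q"
      by (simp add: field_simps)
    have "\<bar>pochhammer (- \<beta>) (Suc p) / fact (Suc p)\<bar> * ?r powr ?q
        = \<bar>pochhammer (- \<beta>) p / fact p\<bar> * (\<bar>- \<beta> + real p\<bar> / ?r * ?r powr ?q)"
      unfolding pochhammer_fact_Suc abs_mult by (simp add: abs_divide)
    also have "\<dots> \<le> \<bar>pochhammer (- \<beta>) p / fact p\<bar> * real p powr ?q"
      using le by (intro mult_left_mono) auto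
    also have "\<dots> \<le> exp (\<beta>\<^sup>2 + \<beta>)"
      by (fact Suc.IH)
    finally show ?thesis .
  qed
qed

section \<open>Truncation and tail of the binomial series\<close>

text \<open>A discrete comparison with the integral of \<open>s powr (- \<beta> - 1)\<close> over
  \<open>[p, p + 1]\<close>, whose sum telescopes. It rests on \<open>(1 + 1 / p) powr \<beta> \<ge>
  exp (\<beta> / (p + 1)) \<ge> 1 + \<beta> / (p + 1)\<close>.\<close>

lemma powr_le_telescope:
  fixes \<beta> :: real
  assumes "0 < \<beta>" "1 \<le> p"
  shows "real (Suc p) powr (- \<beta> - 1) \<le> (real p powr (- \<beta>) - real (Suc p) powr (- \<beta>)) / \<beta>"
proof -
  let ?r = "real (Suc p)"
  have "1 + \<beta> / ?r \<le> exp (\<beta> * (1 / ?r))"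
    using exp_ge_add_one_self[of "\<beta> / ?r"] by simp
  also have "\<dots> \<le> exp (\<beta> * (ln ?r - ln p))"
  proof -
    have "ln (real p / ?r) \<le> real p / ?r - 1"
      using assms by (intro ln_le_minus_one) auto
    then have "1 / ?r \<le> ln ?r - ln p"
      using assms by (simp add: ln_div field_simps)
    then show ?thesis using \<open>0 < \<beta>\<close> by (simp only: exp_le_cancel_iff mult_le_cancel_left_pos)
  qed
  finally have "(1 + \<beta> / ?r) * ?r powr (- \<beta>) \<le> exp (\<beta> * (ln ?r - ln p)) * ?r powr (- \<beta>)"
    by (intro mult_right_mono) auto
  also have "\<dots> = real p powr (- \<beta>)"
    using assms by (simp add: powr_def exp_add[symmetric] algebra_simps)
  finally have "\<beta> * (?r powr (- \<beta>) / ?r) \<le> real p powr (- \<beta>) - ?r powr (- \<beta>)"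
    by (simp add: algebra_simps)
  moreover have "?r powr (- \<beta> - 1) = ?r powr (- \<beta>) / ?r"
    by (simp add: powr_diff)
  ultimately show ?thesis
    using \<open>0 < \<beta>\<close> by (simp only: pos_le_divide_eq mult.commute)
qed

text \<open>The Taylor polynomial of \<open>(1 - u) powr \<beta>\<close> at 0; the Pochhammer form
  of its coefficients matches \<open>coeff_A\<close> and \<open>coeff_B\<close>.\<close>

definition binomial_trunc :: "real \<Rightarrow> nat \<Rightarrow> real \<Rightarrow> real" where
  "binomial_trunc \<beta> m u = (\<Sum>p\<le>m. pochhammer (- \<beta>) p / fact p * u ^ p)"

lemma binomial_trunc_0 [simp]: "binomial_trunc \<beta> m 0 = 1"
proof -
  have "binomial_trunc \<beta> m 0 = (\<Sum>p\<in>{0}. pochhammer (- \<beta>) p / fact p * 0 ^ p)"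
    unfolding binomial_trunc_def by (intro sum.mono_neutral_right) auto
  then show ?thesis by simp
qed

text \<open>Exponent and degree drop together because \<open>pochhammer (- \<beta>) (Suc p) = -
  \<beta> * pochhammer (1 - \<beta>) p\<close>.\<close>

lemma has_field_derivative_binomial_trunc:
  "(binomial_trunc \<beta> (Suc m) has_field_derivative - \<beta> * binomial_trunc (\<beta> - 1) m u) (at u)"
proof -
  have "((\<lambda>u. \<Sum>p\<le>Suc m. pochhammer (- \<beta>) p / fact p * u ^ p) has_field_derivative
      (\<Sum>p\<le>Suc m. pochhammer (- \<beta>) p / fact p * (real p * u ^ (p - 1)))) (at u)"
    by (intro DERIV_sum DERIV_cmult) (auto intro!: derivative_eq_intros)
  also have "(\<Sum>p\<le>Suc m. pochhammer (- \<beta>) p / fact p * (real p * u ^ (p - 1)))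
      = (\<Sum>p\<le>m. pochhammer (- \<beta>) (Suc p) / fact (Suc p) * (real (Suc p) * u ^ p))"
    by (subst sum.atMost_Suc_shift) simp
  also have "\<dots> = - \<beta> * binomial_trunc (\<beta> - 1) m u"
    unfolding binomial_trunc_def sum_distrib_left
    by (intro sum.cong) (auto simp: pochhammer_rec divide_simps)
  finally show ?thesis
    unfolding binomial_trunc_def[abs_def] .
qed

lemma binomial_series_sums:
  fixes u \<beta> :: real
  assumes "\<bar>u\<bar> < 1"
  shows "(\<lambda>p. pochhammer (- \<beta>) p / fact p * u ^ p) sums (1 - u) powr \<beta>"
proof -
  have "(\<lambda>p. (\<beta> gchoose p) * (- u) ^ p) sums (1 + (- u)) powr \<beta>"
    using assms by (intro gen_binomial_real) auto
  moreover have "(\<beta> gchoose p) * (- u) ^ p = pochhammer (- \<beta>) p / fact p * u ^ p" for p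
    unfolding gbinomial_pochhammer by (cases "even p") (auto simp: power_minus_odd)
  ultimately show ?thesis by simp
qed

lemma binomial_trunc_error:
  fixes u \<beta> :: real
  assumes "0 < \<beta>" "1 \<le> N" "0 \<le> u" "u < 1"
  shows "\<bar>(1 - u) powr \<beta> - binomial_trunc \<beta> N u\<bar> \<le> exp (\<beta>\<^sup>2 + \<beta>) / (\<beta> * real N powr \<beta>)"
proof -
  let ?M = "exp (\<beta>\<^sup>2 + \<beta>)"
  let ?c = "\<lambda>p. pochhammer (- \<beta>) p / fact p * u ^ p"
  let ?d = "\<lambda>p. ?M / \<beta> * (real p powr (- \<beta>) - real (Suc p) powr (- \<beta>))"
  have "(\<lambda>p. ?c (p + Suc N)) sums ((1 - u) powr \<beta> - binomial_trunc \<beta> N u)"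
    using sums_split_initial_segment[OF binomial_series_sums, of u \<beta> "Suc N"] assms
    by (simp add: binomial_trunc_def lessThan_Suc_atMost)
  then have eq: "(1 - u) powr \<beta> - binomial_trunc \<beta> N u = (\<Sum>p. ?c (p + Suc N))"
    by (rule sums_unique)
  have lim: "(\<lambda>p. real p powr (- \<beta>)) \<longlonglongrightarrow> 0"
    using assms by (intro tendsto_neg_powr filterlim_real_sequentially) auto
  have "(\<lambda>p. real (p + N) powr (- \<beta>) - real (Suc p + N) powr (- \<beta>)) sums (real (0 + N) powr (- \<beta>) - 0)"
    by (intro telescope_sums' LIMSEQ_ignore_initial_segment lim)
  then have "(\<lambda>p. ?d (p + N)) sums (?M / \<beta> * real N powr (- \<beta>))"
    using sums_mult[of _ _ "?M / \<beta>"] by (simp only: add_Suc add_0 diff_0_right)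
  moreover have bound: "norm (?c (p + Suc N)) \<le> ?d (p + N)" for p
  proof -
    let ?k = "p + Suc N"
    have "norm (?c ?k) = \<bar>pochhammer (- \<beta>) ?k / fact ?k\<bar> * u ^ ?k"
      using \<open>0 \<le> u\<close> by (simp add: abs_mult abs_divide)
    \<comment> \<open>Dropping the power of \<open>u\<close> makes the bound uniform on
      \<open>[0, 1)\<close>.\<close>
    also have "\<dots> \<le> \<bar>pochhammer (- \<beta>) ?k / fact ?k\<bar>"
      using assms by (intro mult_right_le_one_le power_le_one) auto
    also have "\<dots> \<le> ?M * real ?k powr (- \<beta> - 1)"
    proof -
      have "\<bar>pochhammer (- \<beta>) ?k / fact ?k\<bar> \<le> ?M / real ?k powr (\<beta> + 1)"
        using assms by (intro pos_le_divide_eq[THEN iffD2] abs_pochhammer_fact_le) auto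
      also have "\<dots> = ?M * real ?k powr (- \<beta> - 1)"
        using powr_minus_divide[of "real ?k" "\<beta> + 1"] by simp
      finally show ?thesis .
    qed
    also have "\<dots> \<le> ?M * ((real (p + N) powr (- \<beta>) - real (Suc (p + N)) powr (- \<beta>)) / \<beta>)"
      using powr_le_telescope[of \<beta> "p + N"] assms by (intro mult_left_mono) auto
    finally show ?thesis by simp
  qed
  ultimately have "norm (\<Sum>p. ?c (p + Suc N)) \<le> ?M / \<beta> * real N powr (- \<beta>)"
    by (metis (no_types, lifting) norm_suminf_le sums_iff)
  then show ?thesis
    unfolding eq by (simp add: powr_minus_divide)
qed

section \<open>The remainder kernel\<close>

text \<open>Dividing by \<open>Gamma (\<beta> + 1)\<close> absorbs the factor \<open>\<beta>\<close>
  that differentiation produces.\<close>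

definition rl_kernel :: "real \<Rightarrow> real \<Rightarrow> real \<Rightarrow> nat \<Rightarrow> real \<Rightarrow> real" where
  "rl_kernel a t \<beta> m \<tau> =
     ((t - \<tau>) powr \<beta> - (t - a) powr \<beta> * binomial_trunc \<beta> m ((\<tau> - a) / (t - a))) / Gamma (\<beta> + 1)"

lemma rl_kernel_left:
  assumes "a < t"
  shows "rl_kernel a t \<beta> m a = 0"
  using assms by (simp add: rl_kernel_def)

text \<open>Only the polynomial part survives at \<open>t\<close>, because
  \<open>0 powr \<beta> = 0\<close> for every \<open>\<beta>\<close>.\<close>

lemma rl_kernel_right:
  assumes "a < t"
  shows "rl_kernel a t \<beta> m t = - ((t - a) powr \<beta> * binomial_trunc \<beta> m 1 / Gamma (\<beta> + 1))"
  using assms by (simp add: rl_kernel_def)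

lemma continuous_on_binomial_trunc [continuous_intros]:
  assumes "continuous_on S f"
  shows "continuous_on S (\<lambda>x. binomial_trunc \<beta> m (f x))"
  unfolding binomial_trunc_def using assms by (intro continuous_intros)

lemma continuous_on_rl_kernel:
  assumes "0 < \<beta>" "a < t"
  shows "continuous_on {a..t} (rl_kernel a t \<beta> m)"
proof -
  have "Gamma (\<beta> + 1) \<noteq> 0"
    using Gamma_real_pos[of "\<beta> + 1"] assms by linarith
  moreover have "continuous_on {a..t} (\<lambda>\<tau>. (t - \<tau>) powr \<beta>)"
    using assms by (intro continuous_on_powr' continuous_intros) auto
  moreover have "continuous_on {a..t} (\<lambda>\<tau>. binomial_trunc \<beta> m ((\<tau> - a) / (t - a)))"
    using assms by (intro continuous_intros) auto
  ultimately show ?thesis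
    unfolding rl_kernel_def[abs_def]
    by (intro continuous_on_divide continuous_on_diff continuous_on_mult continuous_on_const ballI)
qed

lemma has_field_derivative_rl_kernel:
  assumes "0 < \<beta>" "a < t" "\<tau> < t"
  shows "(rl_kernel a t \<beta> (Suc m) has_field_derivative - rl_kernel a t (\<beta> - 1) m \<tau>) (at \<tau>)"
proof -
  let ?u = "\<lambda>\<tau>. (\<tau> - a) / (t - a)"
  have 1: "((\<lambda>\<tau>. (t - \<tau>) powr \<beta>) has_field_derivative - (\<beta> * (t - \<tau>) powr (\<beta> - 1))) (at \<tau>)"
    using assms by (auto intro!: derivative_eq_intros)
  have "((\<lambda>\<tau>. binomial_trunc \<beta> (Suc m) (?u \<tau>)) has_field_derivative
      (- \<beta> * binomial_trunc (\<beta> - 1) m (?u \<tau>)) * (1 / (t - a))) (at \<tau>)"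
    by (rule DERIV_chain2[OF has_field_derivative_binomial_trunc])
       (use assms in \<open>auto intro!: derivative_eq_intros\<close>)
  then have "(rl_kernel a t \<beta> (Suc m) has_field_derivative
      (- (\<beta> * (t - \<tau>) powr (\<beta> - 1))
        - (t - a) powr \<beta> * ((- \<beta> * binomial_trunc (\<beta> - 1) m (?u \<tau>)) * (1 / (t - a))))
      / Gamma (\<beta> + 1)) (at \<tau>)"
    unfolding rl_kernel_def[abs_def] by (intro DERIV_cdivide DERIV_diff DERIV_cmult 1)
  also have "(- (\<beta> * (t - \<tau>) powr (\<beta> - 1))
        - (t - a) powr \<beta> * ((- \<beta> * binomial_trunc (\<beta> - 1) m (?u \<tau>)) * (1 / (t - a))))
      / Gamma (\<beta> + 1) = - rl_kernel a t (\<beta> - 1) m \<tau>"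
  proof -
    have "Gamma (\<beta> + 1) = \<beta> * Gamma \<beta>"
      using assms by (intro Gamma_plus1) auto
    moreover have "Gamma \<beta> > 0"
      using assms by (intro Gamma_real_pos)
    moreover have "(t - a) powr \<beta> = (t - a) powr (\<beta> - 1) * (t - a)"
      using assms by (simp add: powr_diff)
    moreover have "(- (\<beta> * q) - P * d * (- \<beta> * w * (1 / d))) / (\<beta> * G) = - ((q - P * w) / G)"
      if "d > 0" "G > 0" for q P d w G :: real
      using that \<open>0 < \<beta>\<close> by (simp add: field_simps)
    ultimately show ?thesis
      using assms by (simp add: rl_kernel_def)
  qed
  finally show ?thesis .
qed

lemma abs_rl_kernel_le:
  assumes "0 < \<beta>" "1 \<le> N" "a \<le> \<tau>" "\<tau> < t"
  shows "\<bar>rl_kernel a t \<beta> N \<tau>\<bar>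
    \<le> (t - a) powr \<beta> * exp (\<beta>\<^sup>2 + \<beta>) / (Gamma (\<beta> + 1) * \<beta> * real N powr \<beta>)"
proof -
  define u where "u = (\<tau> - a) / (t - a)"
  have u: "0 \<le> u" "u < 1" "t - \<tau> = (t - a) * (1 - u)"
    using assms by (auto simp: u_def field_simps)
  have G: "Gamma (\<beta> + 1) > 0"
    using assms by (intro Gamma_real_pos) auto
  have "(t - \<tau>) powr \<beta> = (t - a) powr \<beta> * (1 - u) powr \<beta>"
    unfolding u(3) by (rule powr_mult)
  then have "rl_kernel a t \<beta> N \<tau>
      = (t - a) powr \<beta> / Gamma (\<beta> + 1) * ((1 - u) powr \<beta> - binomial_trunc \<beta> N u)"
    unfolding rl_kernel_def u_def[symmetric] by (simp add: right_diff_distrib diff_divide_distrib)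
  then have "\<bar>rl_kernel a t \<beta> N \<tau>\<bar>
      = (t - a) powr \<beta> / Gamma (\<beta> + 1) * \<bar>(1 - u) powr \<beta> - binomial_trunc \<beta> N u\<bar>"
    using G by (simp add: abs_mult)
  also have "\<dots> \<le> (t - a) powr \<beta> / Gamma (\<beta> + 1) * (exp (\<beta>\<^sup>2 + \<beta>) / (\<beta> * real N powr \<beta>))"
    using assms u G by (intro mult_left_mono binomial_trunc_error) auto
  finally show ?thesis by (simp add: mult.assoc)
qed

section \<open>Repeated integration by parts\<close>

lemma nth_deriv_on_0 [simp]: "nth_deriv_on S 0 x = x"
  by (simp add: nth_deriv_on_def)

lemma continuous_on_nth_deriv_on:
  assumes "C_on n S x" "i \<le> n"
  shows "continuous_on S (nth_deriv_on S i x)"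
  using assms by (cases "i = n") (auto simp: C_on_def intro: differentiable_imp_continuous_on)

text \<open>At interior points the derivative within \<open>{a..b}\<close> is the two-sided
  one.\<close>

lemma has_vector_derivative_nth_deriv_on:
  assumes "C_on n {a..b} x" "i < n" "\<tau> \<in> {a<..<b}"
  shows "(nth_deriv_on {a..b} i x has_vector_derivative nth_deriv_on {a..b} (Suc i) x \<tau>) (at \<tau>)"
proof -
  have "nth_deriv_on {a..b} i x differentiable (at \<tau> within {a..b})"
    using assms by (auto simp: C_on_def differentiable_on_def)
  then show ?thesis
    using assms unfolding vector_derivative_works
    by (simp add: nth_deriv_on_def at_within_Icc_at)
qed

text \<open>The leading 1 is the term \<open>k = 0\<close> after the shift
  \<open>k = p + 1 + i - n\<close>. This identifies \<open>coeff_A\<close> with the boundary value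
  of a kernel at \<open>t\<close>.\<close>

lemma coeff_A_eq:
  assumes "i < n" "n \<le> N"
  shows "coeff_A \<alpha> n N i = binomial_trunc (\<alpha> + real i) (N + 1 + i - n) 1 / Gamma (\<alpha> + real i + 1)"
proof -
  let ?c = "\<lambda>k. pochhammer (- \<alpha> - real i) k / fact k"
  have "(\<Sum>p=n-i..N. ?c (p + 1 + i - n)) = (\<Sum>k=1..N + 1 + i - n. ?c k)"
    using assms
    by (intro sum.reindex_bij_witness[of _ "\<lambda>k. k + n - 1 - i" "\<lambda>p. p + 1 + i - n"]) auto
  then have "1 + (\<Sum>p=n-i..N. ?c (p + 1 + i - n)) = (\<Sum>k\<le>N + 1 + i - n. ?c k)"
    by (simp add: atMost_atLeast0 sum.atLeast_Suc_atMost)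
  then show ?thesis
    by (simp add: coeff_A_def binomial_trunc_def)
qed

text \<open>For \<open>\<alpha> < 1\<close> the kernel is unbounded at \<open>t\<close>; in \<open>E_tr_eq_integral\<close> its integrability is
  a by-product of the fundamental theorem of calculus.\<close>

lemma integral_rl_kernel_eq:
  assumes "a < t" "0 < \<alpha>" "n \<le> N" "continuous_on {a..t} x"
    and "(\<lambda>\<tau>. rl_kernel a t (\<alpha> - 1) (N - n) \<tau> * x \<tau>) integrable_on {a..t}"
  shows "integral {a..t} (\<lambda>\<tau>. rl_kernel a t (\<alpha> - 1) (N - n) \<tau> * x \<tau>) =
    RL_integral a \<alpha> x t -
    (\<Sum>p=n..N. coeff_B \<alpha> n p * (t - a) powr (\<alpha> + real n - 1 - real p) * moment_V a n x p t)"
proof -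
  have G: "Gamma \<alpha> > 0"
    using assms by (intro Gamma_real_pos)
  let ?k = "\<lambda>\<tau>. rl_kernel a t (\<alpha> - 1) (N - n) \<tau> * x \<tau>"
  \<comment> \<open>One monomial of the kernel with \<open>k = p - n\<close>. The factor
    \<open>Suc k\<close> is inserted above and, through \<open>fact (Suc k)\<close>, below, to match
    \<open>moment_V\<close> and \<open>coeff_B\<close>.\<close>
  let ?T = "\<lambda>k \<tau>. pochhammer (1 - \<alpha>) k / (Gamma \<alpha> * fact (Suc k)) *
    (t - a) powr (\<alpha> - 1 - real k) * (real (Suc k) * (\<tau> - a) ^ k * x \<tau>)"
  have T: "?T k integrable_on {a..t}" for k
    using assms by (intro integrable_continuous_real continuous_intros)
  have T': "integral {a..t} (?T k) = coeff_B \<alpha> n (k + n) *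
      (t - a) powr (\<alpha> + real n - 1 - real (k + n)) * moment_V a n x (k + n) t" for k
  proof -
    have "\<alpha> + real n - 1 - real (k + n) = \<alpha> - 1 - real k"
      by simp
    then show ?thesis
      by (simp only: coeff_B_def moment_V_def integral_mult_right add_diff_cancel_right' Suc_eq_plus1)
  qed
  have k: "?k \<tau> = (t - \<tau>) powr (\<alpha> - 1) * x \<tau> / Gamma \<alpha> - (\<Sum>k\<le>N - n. ?T k \<tau>)" for \<tau>
  proof -
    have "(t - a) powr (\<alpha> - 1) * (pochhammer (1 - \<alpha>) k / fact k * ((\<tau> - a) / (t - a)) ^ k)
        / Gamma \<alpha> * x \<tau> = ?T k \<tau>" for k
      using assms G by (simp add: powr_diff powr_realpow power_divide divide_simps)
    then show ?thesis
      by (simp add: rl_kernel_def binomial_trunc_def left_diff_distrib diff_divide_distrib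
          sum_distrib_left sum_distrib_right sum_divide_distrib)
  qed
  have sum_T: "((\<lambda>\<tau>. \<Sum>k\<le>N - n. ?T k \<tau>) has_integral (\<Sum>k\<le>N - n. integral {a..t} (?T k))) {a..t}"
    using T by (intro has_integral_sum integrable_integral) auto
  \<comment> \<open>Adding the polynomial part back recovers the possibly singular fractional
    integrand, which inherits its integrability from the kernel.\<close>
  have "((\<lambda>\<tau>. Gamma \<alpha> * (?k \<tau> + (\<Sum>k\<le>N - n. ?T k \<tau>))) has_integral
      Gamma \<alpha> * (integral {a..t} ?k + (\<Sum>k\<le>N - n. integral {a..t} (?T k)))) {a..t}"
    using assms(5) sum_T
    by (intro has_integral_mult_right has_integral_add integrable_integral)
  then have "((\<lambda>\<tau>. (t - \<tau>) powr (\<alpha> - 1) * x \<tau>) has_integral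
      Gamma \<alpha> * (integral {a..t} ?k + (\<Sum>k\<le>N - n. integral {a..t} (?T k)))) {a..t}"
    unfolding k using G by simp
  then have "RL_integral a \<alpha> x t = integral {a..t} ?k + (\<Sum>k\<le>N - n. integral {a..t} (?T k))"
    unfolding RL_integral_def using G by (simp add: integral_unique)
  moreover have "(\<Sum>k\<le>N - n. integral {a..t} (?T k)) =
    (\<Sum>p=n..N. coeff_B \<alpha> n p * (t - a) powr (\<alpha> + real n - 1 - real p) * moment_V a n x p t)"
    unfolding T' using assms
    by (intro sum.reindex_bij_witness[of _ "\<lambda>p. p - n" "\<lambda>k. k + n"]) auto
  ultimately show ?thesis by simp
qed

lemma E_tr_eq_integral:
  assumes "a < t" "t \<le> b" "0 < \<alpha>" "1 \<le> n" "n \<le> N" "C_on n {a..b} x"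
  shows "((\<lambda>\<tau>. rl_kernel a t (\<alpha> + real n - 1) N \<tau> * nth_deriv_on {a..b} n x \<tau>)
    has_integral E_tr a b \<alpha> n N x t) {a..t}"
proof -
  let ?D = "\<lambda>i. nth_deriv_on {a..b} i x"
  \<comment> \<open>As \<open>n \<le> N\<close>, the subtraction does not truncate: the degree
    climbs by one with each \<open>i\<close>, from \<open>N - n\<close> to \<open>N\<close>.\<close>
  let ?K = "\<lambda>i. rl_kernel a t (\<alpha> + real i - 1) (N + i - n)"
  \<comment> \<open>\<open>F\<close> gathers all boundary terms. Its derivative telescopes, so one
    use of the fundamental theorem replaces \<open>n\<close> integrations by parts; only kernels
    with positive exponent occur, so \<open>F\<close> is continuous up to \<open>t\<close>.\<close>
  define F where "F \<tau> = (\<Sum>i<n. ?K (Suc i) \<tau> * ?D i \<tau>)" for \<tau>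
  have contD: "continuous_on {a..t} (?D i)" if "i \<le> n" for i
    using assms that by (intro continuous_on_subset[OF continuous_on_nth_deriv_on]) auto
  have contK: "continuous_on {a..t} (?K i)" if "1 \<le> i" for i
    using assms that by (intro continuous_on_rl_kernel) auto
  have "((\<lambda>\<tau>. ?K n \<tau> * ?D n \<tau> - ?K 0 \<tau> * ?D 0 \<tau>) has_integral F t - F a) {a..t}"
  proof (rule fundamental_theorem_of_calculus_interior)
    show "continuous_on {a..t} F"
      unfolding F_def by (intro continuous_intros contD contK) auto
  next
    fix \<tau> assume \<tau>: "\<tau> \<in> {a<..<t}"
    have "((\<lambda>\<tau>. ?K (Suc i) \<tau> * ?D i \<tau>) has_vector_derivative
        (?K (Suc i) \<tau> * ?D (Suc i) \<tau> - ?K i \<tau> * ?D i \<tau>)) (at \<tau>)" if "i < n" for i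
    proof -
      have "(?K (Suc i) has_vector_derivative - ?K i \<tau>) (at \<tau>)"
        using has_field_derivative_rl_kernel[of "\<alpha> + real i" a t \<tau> "N + i - n"] assms \<tau> that
        by (simp add: has_real_derivative_iff_has_vector_derivative Suc_diff_le)
      moreover have "(?D i has_vector_derivative ?D (Suc i) \<tau>) (at \<tau>)"
        using assms \<tau> that by (intro has_vector_derivative_nth_deriv_on) auto
      ultimately show ?thesis
        using has_vector_derivative_mult by fastforce
    qed
    then have "(F has_vector_derivative
        (\<Sum>i<n. ?K (Suc i) \<tau> * ?D (Suc i) \<tau> - ?K i \<tau> * ?D i \<tau>)) (at \<tau>)"
      unfolding F_def by (intro has_vector_derivative_sum) auto
    then show "(F has_vector_derivative ?K n \<tau> * ?D n \<tau> - ?K 0 \<tau> * ?D 0 \<tau>) (at \<tau>)"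
      by (simp only: sum_lessThan_telescope[of "\<lambda>i. ?K i \<tau> * ?D i \<tau>"])
  qed (use assms in auto)
  moreover have int_n: "(\<lambda>\<tau>. ?K n \<tau> * ?D n \<tau>) integrable_on {a..t}"
    using assms by (intro integrable_continuous_real continuous_intros contD contK) auto
  ultimately have "((\<lambda>\<tau>. ?K n \<tau> * ?D n \<tau> - (?K n \<tau> * ?D n \<tau> - ?K 0 \<tau> * ?D 0 \<tau>)) has_integral
      integral {a..t} (\<lambda>\<tau>. ?K n \<tau> * ?D n \<tau>) - (F t - F a)) {a..t}"
    by (intro has_integral_diff[OF integrable_integral])
  then have K0: "((\<lambda>\<tau>. rl_kernel a t (\<alpha> - 1) (N - n) \<tau> * x \<tau>) has_integral
      integral {a..t} (\<lambda>\<tau>. ?K n \<tau> * ?D n \<tau>) - (F t - F a)) {a..t}"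
    by simp
  have "F a = 0"
    using assms by (simp add: F_def rl_kernel_left)
  moreover have "F t = - (\<Sum>i=0..n-1. coeff_A \<alpha> n N i * (t - a) powr (\<alpha> + real i) * ?D i t)"
  proof -
    \<comment> \<open>This needs \<open>n \<ge> 1\<close>: for \<open>n = 0\<close> the left side
      would be \<open>{0}\<close>.\<close>
    have "{0..n-1} = {..<n}"
      using assms by auto
    moreover have "?K (Suc i) t * ?D i t = - (coeff_A \<alpha> n N i * (t - a) powr (\<alpha> + real i) * ?D i t)"
      if "i < n" for i
      using assms that by (simp add: rl_kernel_right coeff_A_eq)
    ultimately show ?thesis
      by (simp add: F_def sum_negf)
  qed
  moreover have "integral {a..t} (\<lambda>\<tau>. rl_kernel a t (\<alpha> - 1) (N - n) \<tau> * x \<tau>) =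
    RL_integral a \<alpha> x t -
    (\<Sum>p=n..N. coeff_B \<alpha> n p * (t - a) powr (\<alpha> + real n - 1 - real p) * moment_V a n x p t)"
    using assms K0 contD[of 0] by (intro integral_rl_kernel_eq) auto
  ultimately have "integral {a..t} (\<lambda>\<tau>. ?K n \<tau> * ?D n \<tau>) = E_tr a b \<alpha> n N x t"
    using integral_unique[OF K0] by (simp add: E_tr_def)
  then show ?thesis
    using integrable_integral[OF int_n] by simp
qed

section \<open>The final estimate\<close>

theorem mainTheorem3:
  fixes a b \<alpha> t :: real and n N :: nat and x :: "real \<Rightarrow> real"
  assumes "a < b" and "\<alpha> > 0" and "n \<ge> 1" and "N \<ge> n"
    and "C_on n {a..b} x"
    and "t \<in> {a<..b}"
  shows "\<bar>E_tr a b \<alpha> n N x t\<bar> \<le>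
    (SUP \<tau>\<in>{a..t}. \<bar>nth_deriv_on {a..b} n x \<tau>\<bar>) *
    ((t - a) powr (\<alpha> + real n) * exp ((\<alpha> + real n - 1)\<^sup>2 + \<alpha> + real n - 1) /
     (Gamma (\<alpha> + real n) * (\<alpha> + real n - 1) * real N powr (\<alpha> + real n - 1)))"
proof -
  define \<beta> where "\<beta> = \<alpha> + real n - 1"
  let ?D = "nth_deriv_on {a..b} n x"
  let ?L = "SUP \<tau>\<in>{a..t}. \<bar>?D \<tau>\<bar>"
  let ?C = "(t - a) powr \<beta> * exp (\<beta>\<^sup>2 + \<beta>) / (Gamma (\<beta> + 1) * \<beta> * real N powr \<beta>)"
  have \<beta>: "0 < \<beta>" and t: "a < t" "t \<le> b"
    using assms by (auto simp: \<beta>_def)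
  have "continuous_on {a..t} (\<lambda>\<tau>. \<bar>?D \<tau>\<bar>)"
    using assms by (intro continuous_intros continuous_on_subset[OF continuous_on_nth_deriv_on[of n]]) auto
  then have "bdd_above ((\<lambda>\<tau>. \<bar>?D \<tau>\<bar>) ` {a..t})"
    by (intro bounded_imp_bdd_above compact_imp_bounded compact_continuous_image) auto
  then have L: "\<bar>?D \<tau>\<bar> \<le> ?L" if "\<tau> \<in> {a..t}" for \<tau>
    using that by (intro cSUP_upper) auto
  have "0 \<le> ?L"
    using L[of a] t by auto
  have "0 \<le> ?C"
    using \<beta> by (intro divide_nonneg_nonneg mult_nonneg_nonneg) (auto intro: Gamma_real_nonneg)
  have int: "((\<lambda>\<tau>. rl_kernel a t \<beta> N \<tau> * ?D \<tau>) has_integral E_tr a b \<alpha> n N x t) (cbox a t)"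
    unfolding \<beta>_def using E_tr_eq_integral assms t by simp
  \<comment> \<open>The point \<open>t\<close> is left out because the kernel bound comes from the
    series with \<open>u < 1\<close>. The interval length supplies the remaining factor
    \<open>t - a\<close>.\<close>
  have "norm (E_tr a b \<alpha> n N x t) \<le> (?C * ?L) * measure lborel (cbox a t)"
  proof (rule has_integral_bound_spike_finite[OF _ _ int, of _ "{t}"])
    show "0 \<le> ?C * ?L"
      using \<open>0 \<le> ?C\<close> \<open>0 \<le> ?L\<close> by (rule mult_nonneg_nonneg)
    fix \<tau> assume "\<tau> \<in> cbox a t - {t}"
    then show "norm (rl_kernel a t \<beta> N \<tau> * ?D \<tau>) \<le> ?C * ?L"
      unfolding real_norm_def abs_mult using \<beta> assms L \<open>0 \<le> ?C\<close>
      by (intro mult_mono abs_rl_kernel_le) auto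
  qed auto
  also have "\<dots> = ?L * ((t - a) powr (\<beta> + 1) * exp (\<beta>\<^sup>2 + \<beta>) /
     (Gamma (\<beta> + 1) * \<beta> * real N powr \<beta>))"
    using t by (simp add: powr_add)
  finally show ?thesis
    by (simp add: \<beta>_def add_diff_eq add.assoc)
qed

end
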